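(* Let $A$ be a square matrix either over $\mathcal{A}=\mathbb{C}$, or over a commutative algebra $\mathcal{A}$ over $\mathbb{C}$, where in the latter case all matrix elements of $A$ are nilpotent. Suppose that $A^2=aA$ for some $a\in\mathcal{A}$, and that $1-\lambda a$ is invertible for all $\lambda$ in some domain $D\subset\mathbb{C}$ containing $0$. Then for all $\lambda\in D$ $$(I-\lambda A)^{-1}=I+\frac{\lambda}{1-\lambda a}A$$ and $$\det(I-\lambda A)=\exp\left\{\frac{\mathrm{tr}\,A}{a}\log(1-\lambda a)\right\}.$$ In particular, if $\alpha_i,\beta_i$, $i=1,\dots,k$, are odd elements in some graded-commutative algebra over $\mathbb{C}$, and $A$ is the $k\times k$ matrix with entries $A_{ij}=\alpha_i\beta_j$, then $A^2=aA$ where $a=-\mathrm{tr}\,A=-\sum_{i=1}^{k}\alpha_i\beta_i$, and $$\det(I-\lambda A)=\frac{1}{1-\lambda a}.$$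
   Context: For a nilpotent element $a$ of a commutative algebra over $\mathbb{C}$, $-\log(1-a)=a+\frac{a^2}{2}+\frac{a^3}{3}+\cdots$ and $\frac{1}{1-a}=1+a+a^2+\cdots$ (finite sums). The expression $\frac{\mathrm{tr}\,A}{a}\log(1-\lambda a)$ is not an actual division by $a$: in the case of nilpotent matrix elements it means $-\sum_{m\ge1}\frac{\lambda^m}{m}a^{m-1}\,\mathrm{tr}\,A$, which is a finite sum since $a^{m-1}A=A^m=0$ for $m$ large, and $\exp$ is the (finite) exponential series of a nilpotent element. Over $\mathbb{C}$ with $a\ne0$ it has its usual meaning (the exponential does not depend on the branch of the logarithm since $\mathrm{tr}\,A/a$ is an integer), and for $a=0$ it means $-\lambda\,\mathrm{tr}\,A$. Odd elements $\alpha,\beta$ of a graded-commutative algebra satisfy $\alpha\beta=-\beta\alpha$, and even elements are central; in the last statement the determinant is taken over the commutative even subalgebra. *)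

theory Defs
  imports "Jordan_Normal_Form.Determinant" "HOL-Library.Groups_Big_Fun" Complex_Main
begin

text \<open>Associative unital algebras over the complex numbers; \<open>smul\<close> is the scalar multiplication.\<close>

locale complex_algebra = Vector_Spaces.vector_space smul
  for smul :: "complex \<Rightarrow> 'a::ring_1 \<Rightarrow> 'a" +
  assumes smul_mult_left: "smul c x * y = smul c (x * y)"
    and smul_mult_right: "x * smul c y = smul c (x * y)"

text \<open>A grading over the integers is covered by taking for \<open>Ev\<close> and \<open>Od\<close> the sums of the
  homogeneous components of even and of odd degree.\<close>

locale graded_commutative_algebra = complex_algebra smul
  for smul :: "complex \<Rightarrow> 'a::ring_1 \<Rightarrow> 'a" +
  fixes Ev Od :: "'a set"
  assumes subspace_Ev: "module.subspace smul Ev"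
    and subspace_Od: "module.subspace smul Od"
    and Ev_Int_Od: "Ev \<inter> Od = {0}"
    and Ev_plus_Od: "\<exists>e\<in>Ev. \<exists>d\<in>Od. x = e + d"
    and one_Ev: "1 \<in> Ev"
    and Ev_Ev: "x \<in> Ev \<Longrightarrow> y \<in> Ev \<Longrightarrow> x * y \<in> Ev"
    and Ev_Od: "x \<in> Ev \<Longrightarrow> y \<in> Od \<Longrightarrow> x * y \<in> Od"
    and Od_Ev: "x \<in> Od \<Longrightarrow> y \<in> Ev \<Longrightarrow> x * y \<in> Od"
    and Od_Od: "x \<in> Od \<Longrightarrow> y \<in> Od \<Longrightarrow> x * y \<in> Ev"
    and Ev_central: "x \<in> Ev \<Longrightarrow> x * y = y * x"
    and Od_anticommute: "x \<in> Od \<Longrightarrow> y \<in> Od \<Longrightarrow> x * y = - (y * x)"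

definition nilpotent :: "'a::semiring_1 \<Rightarrow> bool"
  where "nilpotent x \<longleftrightarrow> (\<exists>m. x ^ m = 0)"

definition mat_trace :: "'a::comm_monoid_add mat \<Rightarrow> 'a"
  where "mat_trace A = (\<Sum>i<dim_row A. A $$ (i, i))"

text \<open>The inverse of an invertible ring element; unspecified if there is none.\<close>

definition ring_inv :: "'a::ring_1 \<Rightarrow> 'a"
  where "ring_inv x = (THE y. x * y = 1 \<and> y * x = 1)"

text \<open>The exponential series of a nilpotent element: \<^const>\<open>Sum_any\<close> sums over the finite
  set of all \<open>m\<close> whose term is nonzero.\<close>

definition nil_exp :: "(complex \<Rightarrow> 'a \<Rightarrow> 'a) \<Rightarrow> 'a::ring_1 \<Rightarrow> 'a"
  where "nil_exp smul x = Sum_any (\<lambda>m::nat. smul (1 / fact m) (x ^ m))"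

text \<open>The element written $\frac{t}{a}\log(1-\lambda a)$, that is
  $-\sum_{m\ge1}\frac{\lambda^m}{m}a^{m-1}t$; the index below is \<open>m - 1\<close>.  The sum is meaningful
  when \<open>a ^ m * t = 0\<close> for all large \<open>m\<close>, even if \<open>a\<close> is not nilpotent.\<close>

definition nil_log_quot :: "(complex \<Rightarrow> 'a \<Rightarrow> 'a) \<Rightarrow> complex \<Rightarrow> 'a::ring_1 \<Rightarrow> 'a \<Rightarrow> 'a"
  where "nil_log_quot smul l a t =
    - Sum_any (\<lambda>m::nat. smul (l ^ Suc m / of_nat (Suc m)) (a ^ m * t))"

text \<open>The determinant of a square matrix whose entries lie in a commutative subring of a possibly
  noncommutative ring.  The entries commute, so the order of the factors does not matter; by the
  lemma below the value is the library determinant computed in the subring, presented as the image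
  of a commutative ring under a homomorphism.\<close>

definition leibniz_det :: "'a::ring_1 mat \<Rightarrow> 'a"
  where "leibniz_det A = (\<Sum>p\<in>{p. p permutes {0..<dim_row A}}.
    signof p * prod_list (map (\<lambda>i. A $$ (i, p i)) [0..<dim_row A]))"

lemma leibniz_det_hom:
  fixes h :: "'e::comm_ring_1 \<Rightarrow> 'a::ring_1"
  assumes "Ring_Hom.ring_hom h" and "A \<in> carrier_mat n n"
  shows "leibniz_det (map_mat h A) = h (det A)"
proof -
  interpret Ring_Hom.ring_hom h by fact
  have prod: "prod_list (map (\<lambda>i. h (A $$ (i, p i))) [0..<n]) = h (\<Prod>i = 0..<n. A $$ (i, p i))" for p
  proof -
    have "prod_list (map (\<lambda>i. h (f i)) xs) = h (prod_list (map f xs))"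
      for f :: "nat \<Rightarrow> 'e" and xs :: "nat list"
      by (induction xs) (simp_all add: hom_mult)
    then show ?thesis
      by (simp add: prod.distinct_set_conv_list[symmetric])
  qed
  have entries: "map_mat h A $$ (i, p i) = h (A $$ (i, p i))"
    if "p permutes {0..<n}" "i < n" for p i
    using that assms(2) permutes_in_image[of p "{0..<n}" i] by auto
  have "leibniz_det (map_mat h A) = (\<Sum>p\<in>{p. p permutes {0..<n}}.
      signof p * prod_list (map (\<lambda>i. h (A $$ (i, p i))) [0..<n]))"
  proof -
    have eq: "map (\<lambda>i. map_mat h A $$ (i, p i)) [0..<n] = map (\<lambda>i. h (A $$ (i, p i))) [0..<n]"
      if "p permutes {0..<n}" for p
      using entries[OF that] by simp
    then show ?thesis
      unfolding leibniz_det_def using assms(2) by (intro sum.cong) (auto simp only: eq index_map_mat carrier_matD)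
  qed
  also have "\<dots> = h (det A)"
    using assms(2) by (simp add: det_def prod hom_sum hom_mult hom_uminus)
  finally show ?thesis .
qed

end

theory Submission
  imports Defs "HOL-Computational_Algebra.Polynomial_FPS"
begin

text \<open>
  The polynomial \<open>p(x) = det (1 - x A)\<close> satisfies \<open>(1 - a x) p' = - tr A \<cdot> p\<close>: Jacobi's formula gives
  \<open>p' = - tr (A \<cdot> adj (1 - x A))\<close>, and \<open>A\<^sup>2 = a A\<close> gives
  \<open>(1 - x A) ((1 - a x) + x A) = 1 - a x\<close>, so \<open>(1 - a x) adj (1 - x A) = p \<cdot> ((1 - a x) + x A)\<close>.
  Since nonzero integers are invertible, this equation and \<open>p(0) = 1\<close> determine the coefficients of \<open>p\<close>,
  and that \<open>p\<close> is a polynomial forces \<open>\<Prod>k<m. (k a - tr A)\<close> to vanish for large \<open>m\<close>.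
  Over the complex numbers this product makes \<open>tr A\<close> a natural multiple \<open>d a\<close> of \<open>a\<close>, and
  \<open>p = (1 - a x)\<^sup>d\<close>. If \<open>tr A\<close> is nilpotent it makes \<open>a\<^sup>m tr A\<close> vanish for large \<open>m\<close>, so that the
  exponential of the logarithmic series is a polynomial, which solves the same equation.
  In the odd case \<open>tr A = - a\<close>, hence \<open>p = \<Sum>m. a\<^sup>m x\<^sup>m\<close>, which is the inverse of \<open>1 - a x\<close>;
  the entries of \<open>A\<close> are even, hence lie in the center, and the determinant is computed in that
  commutative ring.
\<close>

section \<open>Jacobi's formula for a derivation of a commutative ring\<close>

lemma derivation_prod:
  fixes D :: "'a::comm_ring_1 \<Rightarrow> 'a"
  assumes mult: "\<And>x y. D (x * y) = x * D y + D x * y" and "finite S"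
  shows "D (prod f S) = (\<Sum>i\<in>S. \<Prod>k\<in>S. if k = i then D (f k) else f k)"
  using \<open>finite S\<close>
proof (induction S)
  case empty
  \<comment> \<open>The product rule at \<open>1 * 1\<close> forces \<open>D 1 = 0\<close>, the
    value needed for the empty product.\<close>
  have "D 1 = D 1 + D 1"
    using mult[of 1 1] by simp
  then show ?case by simp
next
  case (insert s S)
  have "(\<Prod>k\<in>S. if k = s then D (f k) else f k) = prod f S"
    using insert.hyps by (intro prod.cong) auto
  moreover have "(\<Sum>i\<in>S. (if s = i then D (f s) else f s) * (\<Prod>k\<in>S. if k = i then D (f k) else f k))
      = f s * D (prod f S)"
    unfolding insert.IH sum_distrib_left using insert.hyps by (intro sum.cong) auto
  ultimately show ?case
    using insert.hyps by (simp add: mult)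
qed

text \<open>The product rule, applied to each term of the Leibniz formula, differentiates one row at
  a time; Laplace expansion along that row then produces the cofactors. The formula is used below
  with \<open>fps_deriv\<close> as the derivation.\<close>

lemma derivation_det:
  fixes D :: "'a::comm_ring_1 \<Rightarrow> 'a"
  assumes add: "\<And>x y. D (x + y) = D x + D y"
    and mult: "\<And>x y. D (x * y) = x * D y + D x * y"
    and M: "M \<in> carrier_mat n n"
  shows "D (det M) = (\<Sum>i<n. \<Sum>j<n. D (M $$ (i, j)) * cofactor M i j)"
proof -
  have D0: "D 0 = 0" using add[of 0 0] by simp
  have Dminus: "D (- x) = - D x" for x
    using add[of x "- x"] D0 by (simp add: eq_neg_iff_add_eq_0 add.commute)
  have Dsum: "D (sum f S) = (\<Sum>i\<in>S. D (f i))" for f :: "(nat \<Rightarrow> nat) \<Rightarrow> 'a" and S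
    by (induction S rule: infinite_finite_induct) (simp_all add: add D0)
  have Dsign: "D (signof p * x) = signof p * D x" for p :: "nat \<Rightarrow> nat" and x
    by (simp add: sign_def Dminus)
  \<comment> \<open>\<open>R i\<close> is \<open>M\<close> with row \<open>i\<close> differentiated.
    Deleting row \<open>i\<close> removes the change, so cofactors along this row are those of
    \<open>M\<close>.\<close>
  define R where "R i = mat n n (\<lambda>(k, j). if k = i then D (M $$ (k, j)) else M $$ (k, j))" for i
  have R: "R i \<in> carrier_mat n n" for i by (simp add: R_def)
  have "D (det M) = (\<Sum>p | p permutes {0..<n}. \<Sum>i<n.
      signof p * (\<Prod>k = 0..<n. R i $$ (k, p k)))"
  proof -
    have "(\<Prod>k = 0..<n. if k = i then D (M $$ (k, p k)) else M $$ (k, p k))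
        = (\<Prod>k = 0..<n. R i $$ (k, p k))" if "p permutes {0..<n}" for p i
      using permutes_in_image[OF that] by (intro prod.cong) (auto simp: R_def)
    then show ?thesis
      unfolding det_def'[OF M] Dsum Dsign
      by (intro sum.cong) (simp_all add: derivation_prod[OF mult] sum_distrib_left lessThan_atLeast0)
  qed
  also have "\<dots> = (\<Sum>i<n. det (R i))"
    unfolding det_def'[OF R] by (rule sum.swap)
  also have "\<dots> = (\<Sum>i<n. \<Sum>j<n. D (M $$ (i, j)) * cofactor M i j)"
  proof (intro sum.cong refl)
    fix i assume i: "i \<in> {..<n}"
    have "mat_delete (R i) i j = mat_delete M i j" for j
      using M by (auto simp: mat_delete_def R_def)
    then show "det (R i) = (\<Sum>j<n. D (M $$ (i, j)) * cofactor M i j)"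
      using i by (subst laplace_expansion_row[OF R, of i i])
        (auto simp: cofactor_def R_def intro!: sum.cong)
  qed
  finally show ?thesis .
qed

section \<open>Matrices with \<open>A * A = a \<cdot>\<^sub>m A\<close>: products and
  inverses\<close>

lemma mat_trace_smult: "mat_trace (c \<cdot>\<^sub>m A) = c * mat_trace A"
  if "A \<in> carrier_mat n n" for A :: "'a::comm_ring_1 mat"
  using that by (simp add: mat_trace_def sum_distrib_left)

text \<open>The relation for \<open>A * A\<close> makes the combinations of the identity and
  \<open>A\<close> closed under multiplication, which reduces the matrix identities below to
  identities between two scalar coefficients.\<close>

lemma linear_in_mat_mult:
  fixes A :: "'a::comm_ring_1 mat"
  assumes A: "A \<in> carrier_mat n n" and AA: "A * A = a \<cdot>\<^sub>m A"
  shows "(x \<cdot>\<^sub>m 1\<^sub>m n + y \<cdot>\<^sub>m A) * (c \<cdot>\<^sub>m 1\<^sub>m n + u \<cdot>\<^sub>m A) =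
      (x * c) \<cdot>\<^sub>m 1\<^sub>m n + (x * u + y * c + y * u * a) \<cdot>\<^sub>m A"
proof (rule eq_matI)
  have [simp]: "dim_row A = n" "dim_col A = n" using A by auto
  fix i j assume "i < dim_row ((x * c) \<cdot>\<^sub>m 1\<^sub>m n + (x * u + y * c + y * u * a) \<cdot>\<^sub>m A)"
    "j < dim_col ((x * c) \<cdot>\<^sub>m 1\<^sub>m n + (x * u + y * c + y * u * a) \<cdot>\<^sub>m A)"
  then have ij: "i < n" "j < n" by auto
  have prod: "(\<Sum>k<n. A $$ (i, k) * A $$ (k, j)) = a * A $$ (i, j)"
    using arg_cong[OF AA, of "\<lambda>X. X $$ (i, j)"] ij
    by (simp add: times_mat_def scalar_prod_def lessThan_atLeast0)
  have "((x \<cdot>\<^sub>m 1\<^sub>m n + y \<cdot>\<^sub>m A) * (c \<cdot>\<^sub>m 1\<^sub>m n + u \<cdot>\<^sub>m A)) $$ (i, j) =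
    (\<Sum>k<n. (x * (if i = k then 1 else 0) + y * A $$ (i, k)) *
       (c * (if k = j then 1 else 0) + u * A $$ (k, j)))"
    using ij by (auto simp: scalar_prod_def lessThan_atLeast0 intro!: sum.cong)
  also have "\<dots> = (\<Sum>k<n. (if i = k then x * (c * (if k = j then 1 else 0) + u * A $$ (k, j)) else 0)
      + (if k = j then y * c * A $$ (i, k) else 0) + y * u * (A $$ (i, k) * A $$ (k, j)))"
    by (intro sum.cong) (auto simp: algebra_simps)
  also have "\<dots> = x * (c * (if i = j then 1 else 0) + u * A $$ (i, j)) + y * c * A $$ (i, j)
      + y * u * (a * A $$ (i, j))"
    using ij by (simp add: sum.distrib prod flip: sum_distrib_left)
  finally show "((x \<cdot>\<^sub>m 1\<^sub>m n + y \<cdot>\<^sub>m A) * (c \<cdot>\<^sub>m 1\<^sub>m n + u \<cdot>\<^sub>m A)) $$ (i, j) =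
    ((x * c) \<cdot>\<^sub>m 1\<^sub>m n + (x * u + y * c + y * u * a) \<cdot>\<^sub>m A) $$ (i, j)"
    using ij by (simp add: algebra_simps)
qed (use A in auto)

lemma one_minus_smult_mat:
  fixes A :: "'a::comm_ring_1 mat"
  assumes "A \<in> carrier_mat n n"
  shows "1\<^sub>m n - s \<cdot>\<^sub>m A = 1 \<cdot>\<^sub>m 1\<^sub>m n + (- s) \<cdot>\<^sub>m A"
  using assms by (intro eq_matI) auto

text \<open>In both products the coefficient of \<open>A\<close> is, up to order of factors,
  \<open>s * ((1 - s * a) * y) - s\<close>, which is zero. Taking \<open>y\<close> as any witness of
  invertibility serves the complex numbers and general algebras alike.\<close>

lemma inverts_one_minus_smult:
  fixes A :: "'a::comm_ring_1 mat"
  assumes A: "A \<in> carrier_mat n n" and AA: "A * A = a \<cdot>\<^sub>m A" and y: "(1 - s * a) * y = 1"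
  shows "inverts_mat (1\<^sub>m n - s \<cdot>\<^sub>m A) (1\<^sub>m n + (s * y) \<cdot>\<^sub>m A)"
    and "inverts_mat (1\<^sub>m n + (s * y) \<cdot>\<^sub>m A) (1\<^sub>m n - s \<cdot>\<^sub>m A)"
proof -
  have "s * y - s - s * (s * y) * a = s * ((1 - s * a) * y) - s"
    by (simp add: algebra_simps)
  then have z: "s * y - s - s * (s * y) * a = 0"
    by (simp add: y)
  have B: "1\<^sub>m n + (s * y) \<cdot>\<^sub>m A = 1 \<cdot>\<^sub>m 1\<^sub>m n + (s * y) \<cdot>\<^sub>m A"
    using A by (intro eq_matI) auto
  have "1 * (s * y) + - s * 1 + - s * (s * y) * a = 0" "1 * - s + s * y * 1 + s * y * - s * a = 0"
    using z by (simp_all add: algebra_simps)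
  then show "inverts_mat (1\<^sub>m n - s \<cdot>\<^sub>m A) (1\<^sub>m n + (s * y) \<cdot>\<^sub>m A)"
    and "inverts_mat (1\<^sub>m n + (s * y) \<cdot>\<^sub>m A) (1\<^sub>m n - s \<cdot>\<^sub>m A)"
    unfolding inverts_mat_def one_minus_smult_mat[OF A] B linear_in_mat_mult[OF A AA]
    using A by (auto intro!: eq_matI)
qed

section \<open>The differential equation of the determinant\<close>

lemma det_one_minus_ode:
  fixes A :: "'a::comm_ring_1 mat"
  assumes A: "A \<in> carrier_mat n n" and AA: "A * A = a \<cdot>\<^sub>m A"
  defines "P \<equiv> det (1\<^sub>m n - fps_X \<cdot>\<^sub>m map_mat fps_const A)"
  shows "(1 - fps_const a * fps_X) * fps_deriv P = - (fps_const (mat_trace A) * P)"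
proof -
  interpret h: comm_ring_hom "fps_const :: 'a \<Rightarrow> 'a fps"
    by unfold_locales auto
  define A' where "A' = map_mat fps_const A"
  define M where "M = 1\<^sub>m n - fps_X \<cdot>\<^sub>m A'"
  define N where "N = (1 - fps_const a * fps_X) \<cdot>\<^sub>m 1\<^sub>m n + fps_X \<cdot>\<^sub>m A'"
  have A': "A' \<in> carrier_mat n n" and M: "M \<in> carrier_mat n n" and N: "N \<in> carrier_mat n n"
    using A by (auto simp: A'_def M_def N_def)
  note adj = adj_mat[OF M]
  have P: "P = det M" by (simp add: P_def M_def A'_def)
  have AA': "A' * A' = fps_const a \<cdot>\<^sub>m A'"
  proof -
    have "A' * A' = map_mat fps_const (A * A)"
      unfolding A'_def by (rule h.mat_hom_mult[OF A A, symmetric])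
    also have "\<dots> = fps_const a \<cdot>\<^sub>m A'"
      unfolding AA A'_def by (intro eq_matI) auto
    finally show ?thesis .
  qed
  have MN: "M * N = (1 - fps_const a * fps_X) \<cdot>\<^sub>m 1\<^sub>m n"
    unfolding M_def N_def one_minus_smult_mat[OF A'] linear_in_mat_mult[OF A' AA'] using A'
    by (intro eq_matI) (auto simp: algebra_simps)
  \<comment> \<open>Evaluating \<open>adj_mat M * M * N\<close> with both bracketings expresses the
    adjugate through \<open>N\<close> without dividing by the determinant.\<close>
  have adjN: "(1 - fps_const a * fps_X) \<cdot>\<^sub>m adj_mat M = P \<cdot>\<^sub>m N"
  proof -
    have "(1 - fps_const a * fps_X) \<cdot>\<^sub>m adj_mat M = adj_mat M * (M * N)"
      unfolding MN using adj(1) by (metis mult_smult_distrib one_carrier_mat right_mult_one_mat)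
    also have "\<dots> = adj_mat M * M * N"
      by (rule assoc_mult_mat[symmetric, OF adj(1) M N])
    also have "\<dots> = P \<cdot>\<^sub>m N"
      unfolding adj(3) P using N by (metis mult_smult_assoc_mat one_carrier_mat left_mult_one_mat)
    finally show ?thesis .
  qed
  \<comment> \<open>The terms \<open>- a x A'\<close> and \<open>x A' * A'\<close> cancel. Hence the
    factor \<open>1 - a x\<close> turns the trace in Jacobi's formula into \<open>P\<close> times
    the trace of \<open>A'\<close>.\<close>
  have AN: "A' * N = A'"
    unfolding N_def using A'
    by (subst mult_add_distrib_mat[OF A'])
      (auto simp: mult_smult_distrib[OF A'] AA' algebra_simps intro!: eq_matI)
  have dM: "fps_deriv (M $$ (i, j)) = - A' $$ (i, j)" if "i < n" "j < n" for i j
    using that A by (auto simp: M_def A'_def)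
  have "fps_deriv P = (\<Sum>i<n. \<Sum>j<n. - A' $$ (i, j) * cofactor M i j)"
    unfolding P
    by (subst derivation_det[OF _ _ M]) (auto simp: fps_deriv_mult dM intro!: sum.cong)
  also have "\<dots> = - mat_trace (A' * adj_mat M)"
    using A' M by (simp add: mat_trace_def scalar_prod_def adj_mat_def lessThan_atLeast0 sum_negf)
  finally have "(1 - fps_const a * fps_X) * fps_deriv P
      = - mat_trace ((1 - fps_const a * fps_X) \<cdot>\<^sub>m (A' * adj_mat M))"
    using A' adj(1) by (subst mat_trace_smult[of _ n]) auto
  also have "(1 - fps_const a * fps_X) \<cdot>\<^sub>m (A' * adj_mat M) = A' * (P \<cdot>\<^sub>m N)"
    unfolding adjN[symmetric] by (rule mult_smult_distrib[OF A' adj(1), symmetric])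
  also have "\<dots> = P \<cdot>\<^sub>m A'"
    using mult_smult_distrib[OF A' N] AN by simp
  also have "mat_trace \<dots> = fps_const (mat_trace A) * P"
    using A by (subst mat_trace_smult[OF A']) (simp add: mat_trace_def A'_def h.hom_sum)
  finally show ?thesis .
qed

text \<open>The determinant is formed once over polynomials, with an indeterminate in place of
  \<open>s\<close>, and carried along two ring homomorphisms: evaluation at \<open>s\<close> gives
  the determinants of interest, and the embedding into power series gives the differential
  equation.\<close>

lemma det_one_minus_poly:
  fixes A :: "'a::comm_ring_1 mat"
  assumes A: "A \<in> carrier_mat n n" and AA: "A * A = a \<cdot>\<^sub>m A"
  obtains p where "\<And>s. det (1\<^sub>m n - s \<cdot>\<^sub>m A) = poly p s" and "coeff p 0 = 1"
    and "(1 - fps_const a * fps_X) * fps_deriv (fps_of_poly p) =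
      - (fps_const (mat_trace A) * fps_of_poly p)"
proof -
  define P where "P = 1\<^sub>m n - [:0, 1:] \<cdot>\<^sub>m map_mat (\<lambda>x. [:x:]) A"
  have p: "det (1\<^sub>m n - s \<cdot>\<^sub>m A) = poly (det P) s" for s
  proof -
    interpret h: comm_ring_hom "\<lambda>q. poly q s"
      by unfold_locales auto
    have "map_mat (\<lambda>q. poly q s) P = 1\<^sub>m n - s \<cdot>\<^sub>m A"
      using A by (auto simp: P_def intro!: eq_matI)
    then show ?thesis
      by (metis h.hom_det)
  qed
  interpret h: comm_ring_hom "fps_of_poly :: 'a poly \<Rightarrow> 'a fps"
    by unfold_locales (auto simp: fps_of_poly_add fps_of_poly_mult)
  have "map_mat fps_of_poly P = 1\<^sub>m n - fps_X \<cdot>\<^sub>m map_mat fps_const A"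
    using A by (intro eq_matI) (auto simp: P_def fps_of_poly_diff fps_of_poly_mult fps_of_poly_const
       simp del: pCons_0_0 mult_pCons_left mult_pCons_right)
  then have fps: "fps_of_poly (det P) = det (1\<^sub>m n - fps_X \<cdot>\<^sub>m map_mat fps_const A)"
    by (metis h.hom_det)
  have "1\<^sub>m n - 0 \<cdot>\<^sub>m A = 1\<^sub>m n"
    using A by (intro eq_matI) auto
  then have "coeff (det P) 0 = 1"
    using p[of 0] by (simp add: poly_0_coeff_0)
  then show ?thesis
    using that[OF p] det_one_minus_ode[OF A AA] unfolding fps by blast
qed

section \<open>Coefficients of the solutions\<close>

lemma fps_ode_nth:
  fixes P :: "'a::comm_ring_1 fps"
  assumes "(1 - fps_const a * fps_X) * fps_deriv P = - (fps_const t * P)"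
  shows "of_nat (Suc m) * fps_nth P (Suc m) = (of_nat m * a - t) * fps_nth P m"
proof -
  have "fps_deriv P - fps_const a * (fps_X * fps_deriv P) = - (fps_const t * P)"
    using assms by (simp add: algebra_simps)
  from arg_cong[OF this, of "\<lambda>F. fps_nth F m"] show ?thesis
    by (cases m) (simp_all add: algebra_simps)
qed

text \<open>This unrolls the recursion \<open>fps_ode_nth\<close>; the factorial stays on the left
  because integers need not be invertible in a general commutative ring. For a polynomial solution
  it makes the product vanish once \<open>m\<close> exceeds the degree.\<close>

lemma fps_ode_nth_prod:
  fixes P :: "'a::comm_ring_1 fps"
  assumes "(1 - fps_const a * fps_X) * fps_deriv P = - (fps_const t * P)" and "fps_nth P 0 = 1"
  shows "of_nat (fact m) * fps_nth P m = (\<Prod>k<m. of_nat k * a - t)"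
proof (induction m)
  case 0
  then show ?case using assms(2) by simp
next
  case (Suc m)
  have "of_nat (fact (Suc m)) * fps_nth P (Suc m) = of_nat (fact m) * (of_nat (Suc m) * fps_nth P (Suc m))"
    by (simp add: algebra_simps)
  also have "\<dots> = (of_nat m * a - t) * (of_nat (fact m) * fps_nth P m)"
    unfolding fps_ode_nth[OF assms(1)] by (simp add: algebra_simps)
  finally show ?case
    unfolding Suc.IH by (simp add: mult.commute)
qed

text \<open>The factor for \<open>k = 0\<close> is \<open>- t\<close>, so modulo
  \<open>t\<^sup>2\<close> every other factor counts only through
  \<open>of_nat k * a\<close>.\<close>

lemma prod_linear_mod_square:
  fixes a t :: "'a::comm_ring_1"
  obtains y where "(\<Prod>k<Suc m. of_nat k * a - t) = t\<^sup>2 * y - of_nat (fact m) * (a ^ m * t)"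
proof -
  have "\<exists>y. (\<Prod>k<Suc m. of_nat k * a - t) = t\<^sup>2 * y - of_nat (fact m) * (a ^ m * t)"
  proof (induction m)
    case 0
    show ?case by (rule exI[of _ 0]) simp
  next
    case (Suc m)
    then obtain y where y: "(\<Prod>k<Suc m. of_nat k * a - t) = t\<^sup>2 * y - of_nat (fact m) * (a ^ m * t)"
      by blast
    have "(\<Prod>k<Suc (Suc m). of_nat k * a - t)
        = (t\<^sup>2 * y - of_nat (fact m) * (a ^ m * t)) * (of_nat (Suc m) * a - t)"
      by (simp only: prod.lessThan_Suc[of _ "Suc m"] y)
    also have "\<dots> = t\<^sup>2 * (y * (of_nat (Suc m) * a - t) + of_nat (fact m) * a ^ m)
        - of_nat (fact (Suc m)) * (a ^ Suc m * t)"
      by (simp add: algebra_simps power2_eq_square)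
    finally show ?case by blast
  qed
  then show ?thesis using that by blast
qed

section \<open>Nilpotent elements and inverses in rings\<close>

lemma nilpotent_add:
  fixes x y :: "'a::comm_ring_1"
  assumes "nilpotent x" "nilpotent y"
  shows "nilpotent (x + y)"
proof -
  obtain m n where x: "x ^ m = 0" and y: "y ^ n = 0"
    using assms by (auto simp: nilpotent_def)
  have "x ^ k * y ^ (m + n - k) = 0" for k
  proof (cases "m \<le> k")
    case True
    then have "x ^ k = x ^ m * x ^ (k - m)" by (simp flip: power_add)
    then show ?thesis by (simp add: x)
  next
    case False
    then have "y ^ (m + n - k) = y ^ n * y ^ (m - k)" by (simp add: add.commute flip: power_add)
    then show ?thesis by (simp add: y)
  qed
  then have "(x + y) ^ (m + n) = 0"
    unfolding binomial_ring by (simp add: mult.assoc)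
  then show ?thesis by (auto simp: nilpotent_def)
qed

lemma nilpotent_mat_trace:
  fixes A :: "'a::comm_ring_1 mat"
  assumes "A \<in> carrier_mat n n" and "\<And>i. i < n \<Longrightarrow> nilpotent (A $$ (i, i))"
  shows "nilpotent (mat_trace A)"
proof -
  have "nilpotent (\<Sum>i<m. A $$ (i, i))" if "m \<le> n" for m
    using that
  proof (induction m)
    case 0
    show ?case by (auto simp: nilpotent_def intro: exI[of _ 1])
  next
    case (Suc m)
    then show ?case by (simp add: nilpotent_add assms(2))
  qed
  then show ?thesis
    using assms(1) by (simp add: mat_trace_def)
qed

lemma ring_inv_eq:
  assumes "x * y = 1" "y * x = 1"
  shows "ring_inv x = y"
  unfolding ring_inv_def
proof (rule the_equality)
  fix z assume "x * z = 1 \<and> z * x = 1"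
  then have "z * (x * y) = y"
    by (simp add: mult.assoc[symmetric])
  then show "z = y"
    using assms by simp
qed (use assms in simp)

section \<open>Commutative complex algebras and the exponential formula\<close>

text \<open>The sort \<open>comm_ring_1\<close> makes \<open>det\<close> and the lemmas above
  applicable. The locale is instantiated below with the given commutative algebra, the complex
  numbers, and the center of a graded-commutative algebra.\<close>

locale comm_complex_algebra = complex_algebra smul
  for smul :: "complex \<Rightarrow> 'a::comm_ring_1 \<Rightarrow> 'a"
begin

text \<open>Replacing the scalar \<open>c\<close> by the ring element \<open>smul c 1\<close> lets
  statements about ring multiples apply to scalar multiples.\<close>

lemma smul_one_mult: "smul c 1 * x = smul c x"
  by (simp add: smul_mult_left)

lemma map_mat_smul: "map_mat (smul c) A = smul c 1 \<cdot>\<^sub>m A"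
  by (intro eq_matI) (simp_all add: smul_one_mult)

lemma smul_of_nat: "smul c (of_nat n * x) = smul (c * of_nat n) x"
proof (induction n)
  case (Suc n)
  then show ?case
    by (simp add: algebra_simps scale_right_distrib scale_left_distrib)
qed simp

lemma smul_power: "(smul c x) ^ n = smul (c ^ n) (x ^ n)"
  by (induction n) (simp_all add: smul_mult_left smul_mult_right mult.commute)

lemma of_nat_mult_cancel:
  fixes x y :: 'a
  assumes "of_nat n * x = of_nat n * y" and "n \<noteq> 0"
  shows "x = y"
  using arg_cong[OF assms(1), of "smul (1 / of_nat n)"] assms(2) by (simp add: smul_of_nat)

lemma fps_ode_unique:
  fixes P Q :: "'a fps"
  assumes "(1 - fps_const a * fps_X) * fps_deriv P = - (fps_const t * P)"
    and "(1 - fps_const a * fps_X) * fps_deriv Q = - (fps_const t * Q)"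
    and "fps_nth P 0 = fps_nth Q 0"
  shows "P = Q"
proof (rule fps_ext)
  fix m show "fps_nth P m = fps_nth Q m"
  proof (induction m)
    case (Suc m)
    have "of_nat (Suc m) * fps_nth P (Suc m) = of_nat (Suc m) * fps_nth Q (Suc m)"
      unfolding fps_ode_nth[OF assms(1)] fps_ode_nth[OF assms(2)] Suc ..
    then show ?case
      by (rule of_nat_mult_cancel) simp
  qed (fact assms(3))
qed

text \<open>Beyond the degree of \<open>p\<close> the product of the factors
  \<open>of_nat k * a - t\<close> vanishes, so \<open>a ^ d * t\<close> is a multiple of
  \<open>t\<^sup>2\<close>. Each further factor \<open>a ^ d\<close> thus gains a factor
  \<open>t\<close>, and nilpotency of \<open>t\<close> ends the process. This makes the logarithmic
  series finite.\<close>

lemma power_mult_trace_eq_0: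
  fixes p :: "'a poly"
  assumes ode: "(1 - fps_const a * fps_X) * fps_deriv (fps_of_poly p) =
      - (fps_const t * fps_of_poly p)"
    and p0: "coeff p 0 = 1" and t: "nilpotent t"
  obtains K where "\<And>m. K \<le> m \<Longrightarrow> a ^ m * t = 0"
proof -
  define d where "d = degree p"
  obtain y where y: "(\<Prod>k<Suc d. of_nat k * a - t) = t\<^sup>2 * y - of_nat (fact d) * (a ^ d * t)"
    by (rule prod_linear_mod_square)
  have "coeff p (Suc d) = 0"
    by (simp add: d_def coeff_eq_0)
  then have "of_nat (fact d) * (a ^ d * t) = t\<^sup>2 * y"
    using fps_ode_nth_prod[OF ode, of "Suc d"] y p0 by simp
  then have "smul (1 / fact d) (of_nat (fact d) * (a ^ d * t)) = smul (1 / fact d) (t\<^sup>2 * y)"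
    by simp
  moreover have "smul (1 / fact d) (of_nat (fact d) * (a ^ d * t)) = a ^ d * t"
    using smul_of_nat[of "1 / fact d" "fact d"] by simp
  ultimately have step: "a ^ d * t = t * (t * smul (1 / fact d) y)"
    by (simp add: smul_mult_right power2_eq_square mult.assoc)
  have it: "a ^ (d * j) * t = t * (t * smul (1 / fact d) y) ^ j" for j
  proof (induction j)
    case (Suc j)
    have "a ^ (d * Suc j) * t = a ^ d * (a ^ (d * j) * t)"
      by (simp add: power_add mult.assoc)
    also have "\<dots> = (a ^ d * t) * (t * smul (1 / fact d) y) ^ j"
      by (simp add: Suc mult.assoc)
    finally show ?case
      by (simp add: step mult.assoc)
  qed simp
  obtain j where "t ^ j = 0"
    using t by (auto simp: nilpotent_def)
  then have K: "a ^ (d * j) * t = 0"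
    by (simp add: it power_mult_distrib)
  have "a ^ m * t = 0" if "d * j \<le> m" for m
  proof -
    have "a ^ m * t = a ^ (m - d * j) * (a ^ (d * j) * t)"
      using that by (simp add: mult.assoc[symmetric] power_add[symmetric])
    then show ?thesis by (simp add: K)
  qed
  then show ?thesis by (rule that)
qed

text \<open>\<open>Q\<close> is the exponential of \<open>F\<close>, and the chain rule gives
  \<open>fps_deriv Q = fps_deriv F * Q\<close>. Differentiation shortens the truncated sum by one
  term, but the missing term contains \<open>F ^ N = 0\<close>.\<close>

lemma fps_ode_exp:
  fixes F :: "'a fps"
  assumes F: "(1 - fps_const a * fps_X) * fps_deriv F = - fps_const t" and N: "F ^ N = 0"
  defines "Q \<equiv> \<Sum>k<Suc N. fps_const (smul (1 / fact k) 1) * F ^ k"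
  shows "(1 - fps_const a * fps_X) * fps_deriv Q = - (fps_const t * Q)"
proof -
  have coeff: "fps_const (smul (1 / fact (Suc k)) 1) * of_nat (Suc k) = fps_const (smul (1 / fact k) 1)"
    for k :: nat
  proof -
    have "smul (1 / fact (Suc k)) 1 * of_nat (Suc k) = smul (1 / fact k) 1"
      using smul_of_nat[of "1 / fact (Suc k)" "Suc k" 1]
      by (simp add: smul_mult_left mult.commute[of "complex_of_nat (Suc k)"] del: of_nat_Suc)
    then show ?thesis
      by (metis fps_const_mult fps_of_nat)
  qed
  have "fps_deriv Q = (\<Sum>k<Suc N. fps_const (smul (1 / fact k) 1) * (of_nat k * fps_deriv F * F ^ (k - 1)))"
    unfolding Q_def by (simp add: fps_deriv_sum fps_deriv_power' del: sum.lessThan_Suc)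
  also have "\<dots> = (\<Sum>k<N. fps_const (smul (1 / fact (Suc k)) 1) * of_nat (Suc k) * (fps_deriv F * F ^ k))"
    by (subst sum.lessThan_Suc_shift) (simp add: mult_ac del: of_nat_Suc)
  also have "\<dots> = fps_deriv F * (\<Sum>k<N. fps_const (smul (1 / fact k) 1) * F ^ k)"
    unfolding coeff sum_distrib_left by (simp add: mult_ac)
  also have "\<dots> = fps_deriv F * Q"
    by (simp add: Q_def N)
  finally show ?thesis
    using F by (metis mult.assoc mult_minus_left)
qed

text \<open>With the scalar replaced by an indeterminate, the right-hand side becomes a polynomial
  \<open>q\<close> that solves the same differential equation as \<open>p\<close> with the same
  constant term. Uniqueness gives \<open>p = q\<close>, which is then evaluated at
  \<open>smul l 1\<close>.\<close>

lemma det_eq_nil_exp: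
  fixes A :: "'a mat"
  assumes A: "A \<in> carrier_mat n n" and AA: "A * A = a \<cdot>\<^sub>m A" and nil: "nilpotent (mat_trace A)"
  shows "det (1\<^sub>m n - map_mat (smul l) A) = nil_exp smul (nil_log_quot smul l a (mat_trace A))"
proof -
  define t where "t = mat_trace A"
  obtain p where p: "\<And>s. det (1\<^sub>m n - s \<cdot>\<^sub>m A) = poly p s" and p0: "coeff p 0 = 1"
    and ode: "(1 - fps_const a * fps_X) * fps_deriv (fps_of_poly p) =
      - (fps_const t * fps_of_poly p)"
    unfolding t_def by (rule det_one_minus_poly[OF A AA]) blast
  obtain K where K: "\<And>m. K \<le> m \<Longrightarrow> a ^ m * t = 0"
    using power_mult_trace_eq_0[OF ode p0] nil unfolding t_def by blast
  obtain N where N: "t ^ N = 0"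
    using nil unfolding t_def nilpotent_def by blast
  \<comment> \<open>\<open>g\<close> is the series of \<open>log (1 - a x) / a\<close>, cut off
    where \<open>a ^ m * t\<close> starts to vanish; \<open>f\<close> is its multiple by the trace
    and \<open>q\<close> the exponential of \<open>f\<close>.\<close>
  define g where "g = (\<Sum>m<K. monom (- smul (1 / of_nat (Suc m)) (a ^ m)) (Suc m))"
  define f where "f = smult t g"
  define q where "q = (\<Sum>k<Suc N. smult (smul (1 / fact k) 1) (f ^ k))"
  have fN: "f ^ N = 0"
    by (simp add: f_def smult_power N)
  have g_nth: "of_nat (Suc m) * coeff g (Suc m) = - (if m < K then a ^ m else 0)" for m
  proof -
    have "coeff g (Suc m) = (if m < K then - smul (1 / of_nat (Suc m)) (a ^ m) else 0)"
      by (simp add: g_def coeff_sum del: of_nat_Suc)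
    moreover have "of_nat (Suc m) * smul (1 / of_nat (Suc m)) x = x" for x
      using smul_of_nat[of "1 / of_nat (Suc m)" "Suc m" x]
      by (simp add: smul_mult_right del: of_nat_Suc)
    ultimately show ?thesis by (simp del: of_nat_Suc)
  qed
  \<comment> \<open>The cutoff leaves no mark after multiplication by \<open>t\<close>, since
    \<open>a ^ m * t = 0\<close> from \<open>K\<close> on; so the formula holds for all
    \<open>m\<close>.\<close>
  have f_nth: "fps_nth (fps_deriv (fps_of_poly f)) m = - (a ^ m * t)" for m
    using arg_cong[OF g_nth[of m], of "(*) t"] K[of m]
    by (cases "m < K") (simp_all add: f_def mult.assoc mult.commute[of t] del: of_nat_Suc)
  have "(1 - fps_const a * fps_X) * fps_deriv (fps_of_poly f) = - fps_const t"
  proof (rule fps_ext)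
    fix m
    have "fps_nth (fps_deriv (fps_of_poly f) - fps_const a * (fps_X * fps_deriv (fps_of_poly f))) m
        = fps_nth (- fps_const t) m"
      by (cases m) (simp_all add: f_nth mult.assoc del: fps_deriv_nth)
    then show "fps_nth ((1 - fps_const a * fps_X) * fps_deriv (fps_of_poly f)) m
        = fps_nth (- fps_const t) m"
      by (simp add: algebra_simps)
  qed
  moreover have "fps_of_poly f ^ N = 0"
    by (simp add: fN flip: fps_of_poly_power)
  ultimately have q_ode: "(1 - fps_const a * fps_X) * fps_deriv (fps_of_poly q) =
      - (fps_const t * fps_of_poly q)"
    unfolding q_def fps_of_poly_sum fps_of_poly_smult fps_of_poly_power by (rule fps_ode_exp)
  have q0: "coeff q 0 = 1"
  proof -
    have "poly f 0 = 0" by (simp add: f_def g_def poly_sum poly_monom)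
    then have "poly q 0 = (\<Sum>k<Suc N. if k = 0 then 1 else 0)"
      unfolding q_def poly_sum by (intro sum.cong) (auto simp: power_0_left)
    then show ?thesis by (simp add: poly_0_coeff_0)
  qed
  have "fps_of_poly p = fps_of_poly q"
    by (rule fps_ode_unique[OF ode q_ode]) (simp add: p0 q0)
  then have pq: "p = q" by (simp add: fps_of_poly_eq_iff)
  have "poly f (smul l 1) = nil_log_quot smul l a t"
  proof -
    \<comment> \<open>\<open>Sum_any\<close> agrees with the truncated sum because its support lies
      below the cutoff; the same argument serves the exponential below.\<close>
    have "{m. smul (l ^ Suc m / of_nat (Suc m)) (a ^ m * t) \<noteq> 0} \<subseteq> {..<K}"
      by (rule subsetI, rule ccontr) (simp add: K not_less del: of_nat_Suc power_Suc)
    then have "nil_log_quot smul l a t = - (\<Sum>m<K. smul (l ^ Suc m / of_nat (Suc m)) (a ^ m * t))"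
      unfolding nil_log_quot_def
      by (subst Sum_any.expand_superset[of "{..<K}"]) (simp_all del: of_nat_Suc power_Suc)
    also have "\<dots> = poly f (smul l 1)"
      by (simp add: f_def g_def poly_sum poly_monom smul_power smul_mult_left smul_mult_right
          sum_distrib_left sum_negf mult_ac del: of_nat_Suc power_Suc)
    finally show ?thesis by simp
  qed
  moreover have "nil_exp smul (poly f s) = poly q s" for s
  proof -
    have zero: "poly f s ^ k = 0" if "Suc N \<le> k" for k
    proof -
      have "f ^ k = f ^ N * f ^ (k - N)" using that by (simp flip: power_add)
      then show ?thesis by (simp add: fN flip: poly_power)
    qed
    have "{k. smul (1 / fact k) (poly f s ^ k) \<noteq> 0} \<subseteq> {..<Suc N}"
      by (rule subsetI, rule ccontr) (simp add: zero not_less)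
    then show ?thesis
      unfolding nil_exp_def
      by (subst Sum_any.expand_superset[of "{..<Suc N}"])
        (simp_all add: q_def poly_sum smul_one_mult del: sum.lessThan_Suc)
  qed
  ultimately show ?thesis
    unfolding map_mat_smul p pq t_def[symmetric] by metis
qed

end

section \<open>Complex matrices\<close>

lemma comm_complex_algebra_complex: "comm_complex_algebra ((*) :: complex \<Rightarrow> _)"
  by unfold_locales (simp_all add: algebra_simps)

text \<open>In a field the vanishing product has a vanishing factor, which supplies
  \<open>d\<close>. Then \<open>(1 - a x) ^ d\<close> solves the differential equation of the
  determinant. For \<open>a = 0\<close> the trace is zero and the determinant is one.\<close>

lemma det_complex:
  fixes A :: "complex mat"
  assumes A: "A \<in> carrier_mat n n" and AA: "A * A = a \<cdot>\<^sub>m A"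
  obtains d :: nat where "mat_trace A = of_nat d * a"
    and "\<And>l. det (1\<^sub>m n - l \<cdot>\<^sub>m A) = (1 - l * a) ^ d"
proof -
  interpret comm_complex_algebra "(*) :: complex \<Rightarrow> _"
    by (rule comm_complex_algebra_complex)
  obtain p where p: "\<And>s. det (1\<^sub>m n - s \<cdot>\<^sub>m A) = poly p s" and p0: "coeff p 0 = 1"
    and ode: "(1 - fps_const a * fps_X) * fps_deriv (fps_of_poly p) =
      - (fps_const (mat_trace A) * fps_of_poly p)"
    by (rule det_one_minus_poly[OF A AA]) blast
  have "(\<Prod>k<Suc (degree p). of_nat k * a - mat_trace A) = 0"
    using fps_ode_nth_prod[OF ode, of "Suc (degree p)"] p0 by (simp add: coeff_eq_0)
  then obtain d where "of_nat d * a = mat_trace A"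
    by (auto simp del: prod.lessThan_Suc)
  then have d: "mat_trace A = of_nat d * a" by simp
  define r where "r = [:1, - a:]"
  have r: "fps_of_poly r = 1 - fps_const a * fps_X"
    by (simp add: r_def fps_of_poly_pCons algebra_simps flip: fps_const_neg)
  have "(1 - fps_const a * fps_X) * fps_deriv (fps_of_poly (r ^ d))
      = of_nat d * (- fps_const a) * (1 - fps_const a * fps_X) ^ d"
    unfolding fps_of_poly_power r fps_deriv_power' by (cases d) (simp_all del: of_nat_Suc)
  also have "\<dots> = - (fps_const (mat_trace A) * fps_of_poly (r ^ d))"
    unfolding fps_of_poly_power r d fps_const_mult[symmetric] fps_of_nat by (simp del: fps_const_neg)
  finally have "fps_of_poly p = fps_of_poly (r ^ d)"
    by (intro fps_ode_unique[OF ode]) (simp_all add: p0 coeff_0_power r_def)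
  then have "p = r ^ d" by (simp add: fps_of_poly_eq_iff)
  then show ?thesis
    by (intro that[OF d]) (simp add: p r_def)
qed

section \<open>The center as a commutative complex algebra\<close>

text \<open>A type cannot depend on the locale parameter \<open>Ev\<close>. The center depends on
  the ring alone, contains \<open>Ev\<close> by \<open>Ev_central\<close>, and is commutative, so
  \<open>det\<close> is available over it.\<close>

typedef (overloaded) 'a center = "{z :: 'a::ring_1. \<forall>x. z * x = x * z}"
  morphisms of_center Center
  by (rule exI[of _ 0]) simp

setup_lifting type_definition_center

lemma of_center_commute: "of_center z * x = x * of_center z"
  using of_center[of z] by simp

instantiation center :: (ring_1) comm_ring_1
begin

lift_definition zero_center :: "'a center" is 0 by simp
lift_definition one_center :: "'a center" is 1 by simp
lift_definition plus_center :: "'a center \<Rightarrow> 'a center \<Rightarrow> 'a center" is "(+)"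
  by (simp add: algebra_simps)
lift_definition uminus_center :: "'a center \<Rightarrow> 'a center" is uminus
  by simp
lift_definition minus_center :: "'a center \<Rightarrow> 'a center \<Rightarrow> 'a center" is "(-)"
  by (simp add: algebra_simps)
lift_definition times_center :: "'a center \<Rightarrow> 'a center \<Rightarrow> 'a center" is "(*)"
  by (metis mult.assoc)

instance
  by standard
    (auto simp: of_center_inject[symmetric] zero_center.rep_eq one_center.rep_eq plus_center.rep_eq
      uminus_center.rep_eq minus_center.rep_eq times_center.rep_eq algebra_simps
      intro: of_center_commute)

end

lemma of_center_hom: "Ring_Hom.ring_hom (of_center :: 'a::ring_1 center \<Rightarrow> 'a)"
  by unfold_locales
    (simp_all add: zero_center.rep_eq one_center.rep_eq plus_center.rep_eq times_center.rep_eq)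

definition center_smul :: "(complex \<Rightarrow> 'a \<Rightarrow> 'a) \<Rightarrow> complex \<Rightarrow> 'a::ring_1 center \<Rightarrow> 'a center"
  where "center_smul smul c z = Center (smul c (of_center z))"

context complex_algebra
begin

lemma of_center_smul: "of_center (center_smul smul c z) = smul c (of_center z)"
  using of_center[of z] unfolding center_smul_def
  by (subst Center_inverse) (simp_all add: smul_mult_left smul_mult_right)

lemma comm_complex_algebra_center: "comm_complex_algebra (center_smul smul)"
  by unfold_locales
    (simp_all add: of_center_inject[symmetric] of_center_smul plus_center.rep_eq times_center.rep_eq
      scale_right_distrib scale_left_distrib smul_mult_left smul_mult_right)

end

section \<open>Matrices of products of odd elements\<close>

text \<open>For trace \<open>- a\<close> the recursion reads
  \<open>(m + 1) p_(m+1) = (m + 1) a p_m\<close>, so \<open>p\<close> has the coefficients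
  \<open>a ^ m\<close> of the geometric series, and its product with \<open>1 - a x\<close>
  telescopes. Invertibility of \<open>1 - s * a\<close> is thereby a result.\<close>

lemma (in comm_complex_algebra) det_eq_inverse:
  fixes A :: "'a mat"
  assumes A: "A \<in> carrier_mat n n" and AA: "A * A = a \<cdot>\<^sub>m A" and a: "a = - mat_trace A"
  shows "(1 - s * a) * det (1\<^sub>m n - s \<cdot>\<^sub>m A) = 1"
proof -
  obtain p where p: "\<And>s. det (1\<^sub>m n - s \<cdot>\<^sub>m A) = poly p s" and p0: "coeff p 0 = 1"
    and ode: "(1 - fps_const a * fps_X) * fps_deriv (fps_of_poly p) =
      - (fps_const (mat_trace A) * fps_of_poly p)"
    by (rule det_one_minus_poly[OF A AA]) blast
  have coeff: "coeff p m = a ^ m" for m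
  proof (induction m)
    case (Suc m)
    have "of_nat m * a - mat_trace A = of_nat (Suc m) * a"
      using a by (simp add: algebra_simps)
    then have "of_nat (Suc m) * coeff p (Suc m) = of_nat (Suc m) * a ^ Suc m"
      using fps_ode_nth[OF ode, of m] by (simp add: Suc mult.assoc del: of_nat_Suc)
    then show ?case
      by (rule of_nat_mult_cancel) simp
  qed (simp add: p0)
  have "[:1, - a:] * p = 1"
  proof (rule poly_eqI)
    fix m show "coeff ([:1, - a:] * p) m = coeff 1 m"
      by (cases m) (simp_all add: coeff)
  qed
  from arg_cong[OF this, of "\<lambda>q. poly q s"] show ?thesis
    by (simp add: p algebra_simps)
qed

text \<open>The entries of \<open>A\<close> are even, hence central. The matrix is lifted to the
  center, where \<open>det_eq_inverse\<close> applies, and \<open>leibniz_det_hom\<close> carries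
  the result back. Both orders of the product are recorded because \<open>ring_inv\<close> asks for
  a two-sided inverse.\<close>

lemma (in graded_commutative_algebra) odd_rank_one:
  fixes \<alpha> \<beta> :: "nat \<Rightarrow> 'a"
  assumes odd: "\<forall>i<k. \<alpha> i \<in> Od \<and> \<beta> i \<in> Od"
  defines "A \<equiv> mat k k (\<lambda>(i, j). \<alpha> i * \<beta> j)"
  defines "a \<equiv> - mat_trace A"
  shows "a = - (\<Sum>i<k. \<alpha> i * \<beta> i)"
    and "A * A = a \<cdot>\<^sub>m A"
    and "(1 - smul l a) * leibniz_det (1\<^sub>m k - map_mat (smul l) A) = 1"
    and "leibniz_det (1\<^sub>m k - map_mat (smul l) A) * (1 - smul l a) = 1"
proof -
  show a: "a = - (\<Sum>i<k. \<alpha> i * \<beta> i)"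
    by (simp add: a_def A_def mat_trace_def)
  have central: "\<alpha> i * \<beta> j * x = x * (\<alpha> i * \<beta> j)" if "i < k" "j < k" for i j x
    using odd that by (intro Ev_central Od_Od) auto
  show AA: "A * A = a \<cdot>\<^sub>m A"
  proof (rule eq_matI)
    fix i j assume "i < dim_row (a \<cdot>\<^sub>m A)" "j < dim_col (a \<cdot>\<^sub>m A)"
    then have ij: "i < k" "j < k" by (auto simp: A_def)
    \<comment> \<open>Exchanging the inner pair \<open>\<beta> m * \<alpha> m\<close> produces the
      sign; the resulting even product is central and moves to the front, where summing over
      \<open>m\<close> gives \<open>a\<close>.\<close>
    have "(\<alpha> i * \<beta> m) * (\<alpha> m * \<beta> j) = - (\<alpha> m * \<beta> m * (\<alpha> i * \<beta> j))" if "m < k" for m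
    proof -
      have "\<beta> m * \<alpha> m = - (\<alpha> m * \<beta> m)"
        using odd that by (intro Od_anticommute) auto
      then have "(\<alpha> i * \<beta> m) * (\<alpha> m * \<beta> j) = - (\<alpha> i * (\<alpha> m * \<beta> m) * \<beta> j)"
        by (metis mult.assoc mult_minus_left mult_minus_right)
      then show ?thesis
        using central[OF that that, of "\<alpha> i"] by (metis mult.assoc)
    qed
    then show "(A * A) $$ (i, j) = (a \<cdot>\<^sub>m A) $$ (i, j)"
      using ij unfolding a
      by (simp add: A_def scalar_prod_def sum_distrib_right sum_negf lessThan_atLeast0)
  qed (auto simp: A_def)
  interpret C: comm_complex_algebra "center_smul smul"
    by (rule comm_complex_algebra_center)
  interpret h: Ring_Hom.ring_hom "of_center :: 'a center \<Rightarrow> 'a"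
    by (rule of_center_hom)
  define A' where "A' = map_mat Center A"
  have A': "A' \<in> carrier_mat k k" by (simp add: A'_def A_def)
  \<comment> \<open>Centrality of the entries is what makes \<open>Center\<close> a true lift
    here.\<close>
  have of_A': "of_center (A' $$ (i, j)) = A $$ (i, j)" if "i < k" "j < k" for i j
    using that central[OF that] by (simp add: A'_def A_def Center_inverse)
  define a' where "a' = - mat_trace A'"
  have of_a': "of_center a' = a"
    using A' by (simp add: a'_def a_def mat_trace_def h.hom_uminus h.hom_sum of_A')
      (simp add: A_def)
  have "A' * A' = a' \<cdot>\<^sub>m A'"
  proof (rule eq_matI)
    fix i j assume "i < dim_row (a' \<cdot>\<^sub>m A')" "j < dim_col (a' \<cdot>\<^sub>m A')"
    then have ij: "i < k" "j < k" using A' by auto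
    have "of_center ((A' * A') $$ (i, j)) = (A * A) $$ (i, j)"
      using ij A' by (simp add: scalar_prod_def h.hom_sum h.hom_mult of_A') (simp add: A_def scalar_prod_def)
    also have "\<dots> = of_center ((a' \<cdot>\<^sub>m A') $$ (i, j))"
      unfolding AA using ij A' by (simp add: h.hom_mult of_A' of_a') (simp add: A_def)
    finally show "(A' * A') $$ (i, j) = (a' \<cdot>\<^sub>m A') $$ (i, j)"
      by (simp add: of_center_inject)
  qed (use A' in auto)
  define s where "s = center_smul smul l 1"
  have inv: "(1 - s * a') * det (1\<^sub>m k - s \<cdot>\<^sub>m A') = 1"
    by (rule C.det_eq_inverse) (fact | simp add: a'_def)+
  have "map_mat of_center (1\<^sub>m k - s \<cdot>\<^sub>m A') = 1\<^sub>m k - map_mat (smul l) A"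
    using A' by (intro eq_matI)
      (auto simp: A_def h.hom_minus h.hom_mult of_A' s_def of_center_smul smul_mult_left)
  moreover have "1\<^sub>m k - s \<cdot>\<^sub>m A' \<in> carrier_mat k k"
    using A' by auto
  ultimately have det: "leibniz_det (1\<^sub>m k - map_mat (smul l) A) = of_center (det (1\<^sub>m k - s \<cdot>\<^sub>m A'))"
    using leibniz_det_hom[OF of_center_hom] by metis
  have of_s: "of_center (1 - s * a') = 1 - smul l a"
    by (simp add: h.hom_minus h.hom_mult s_def of_center_smul smul_mult_left of_a')
  show "(1 - smul l a) * leibniz_det (1\<^sub>m k - map_mat (smul l) A) = 1"
    using arg_cong[OF inv, of of_center] unfolding det by (simp add: h.hom_mult of_s)
  show "leibniz_det (1\<^sub>m k - map_mat (smul l) A) * (1 - smul l a) = 1"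
    using arg_cong[OF inv[unfolded mult.commute[of "1 - s * a'"]], of of_center] unfolding det
    by (simp add: h.hom_mult of_s)
qed

section \<open>Inverse and determinant formulas in the three settings\<close>

theorem lemma5:
  fixes smul :: "complex \<Rightarrow> 'a::comm_ring_1 \<Rightarrow> 'a"
    and gsmul :: "complex \<Rightarrow> 'b::ring_1 \<Rightarrow> 'b"
    and Ev Od :: "'b set"
  shows
    "(\<forall>(n::nat) (A::complex mat) (a::complex) (D::complex set).
        A \<in> carrier_mat n n \<longrightarrow> A * A = a \<cdot>\<^sub>m A \<longrightarrow>
        open D \<longrightarrow> connected D \<longrightarrow> 0 \<in> D \<longrightarrow>
        (\<forall>l\<in>D. 1 - l * a \<noteq> 0) \<longrightarrow>
        (\<forall>l\<in>D.
           let B = 1\<^sub>m n + (l / (1 - l * a)) \<cdot>\<^sub>m A in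
           inverts_mat (1\<^sub>m n - l \<cdot>\<^sub>m A) B \<and> inverts_mat B (1\<^sub>m n - l \<cdot>\<^sub>m A) \<and>
           (a = 0 \<longrightarrow> det (1\<^sub>m n - l \<cdot>\<^sub>m A) = exp (- l * mat_trace A)) \<and>
           (a \<noteq> 0 \<longrightarrow> (\<forall>w. exp w = 1 - l * a \<longrightarrow>
              det (1\<^sub>m n - l \<cdot>\<^sub>m A) = exp (mat_trace A / a * w)))))
     \<and>
     (complex_algebra smul \<longrightarrow>
      (\<forall>(n::nat) (A::'a mat) (a::'a) (D::complex set).
        A \<in> carrier_mat n n \<longrightarrow> (\<forall>i<n. \<forall>j<n. nilpotent (A $$ (i, j))) \<longrightarrow>
        A * A = a \<cdot>\<^sub>m A \<longrightarrow>
        open D \<longrightarrow> connected D \<longrightarrow> 0 \<in> D \<longrightarrow>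
        (\<forall>l\<in>D. (1 - smul l a) dvd 1) \<longrightarrow>
        (\<forall>l\<in>D.
           let M = 1\<^sub>m n - map_mat (smul l) A;
               B = 1\<^sub>m n + smul l (ring_inv (1 - smul l a)) \<cdot>\<^sub>m A in
           inverts_mat M B \<and> inverts_mat B M \<and>
           det M = nil_exp smul (nil_log_quot smul l a (mat_trace A)))))
     \<and>
     (graded_commutative_algebra gsmul Ev Od \<longrightarrow>
      (\<forall>(k::nat) (\<alpha>::nat \<Rightarrow> 'b) (\<beta>::nat \<Rightarrow> 'b).
        (\<forall>i<k. \<alpha> i \<in> Od \<and> \<beta> i \<in> Od) \<longrightarrow>
        (let A = mat k k (\<lambda>(i, j). \<alpha> i * \<beta> j);
             a = - mat_trace A in
         a = - (\<Sum>i<k. \<alpha> i * \<beta> i) \<and>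
         A * A = a \<cdot>\<^sub>m A \<and>
         (\<forall>l::complex.
            (\<exists>y. (1 - gsmul l a) * y = 1 \<and> y * (1 - gsmul l a) = 1) \<and>
            leibniz_det (1\<^sub>m k - map_mat (gsmul l) A) = ring_inv (1 - gsmul l a)))))"
proof (intro conjI)
  show "\<forall>(n::nat) (A::complex mat) (a::complex) (D::complex set).
        A \<in> carrier_mat n n \<longrightarrow> A * A = a \<cdot>\<^sub>m A \<longrightarrow>
        open D \<longrightarrow> connected D \<longrightarrow> 0 \<in> D \<longrightarrow>
        (\<forall>l\<in>D. 1 - l * a \<noteq> 0) \<longrightarrow>
        (\<forall>l\<in>D.
           let B = 1\<^sub>m n + (l / (1 - l * a)) \<cdot>\<^sub>m A in
           inverts_mat (1\<^sub>m n - l \<cdot>\<^sub>m A) B \<and> inverts_mat B (1\<^sub>m n - l \<cdot>\<^sub>m A) \<and>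
           (a = 0 \<longrightarrow> det (1\<^sub>m n - l \<cdot>\<^sub>m A) = exp (- l * mat_trace A)) \<and>
           (a \<noteq> 0 \<longrightarrow> (\<forall>w. exp w = 1 - l * a \<longrightarrow>
              det (1\<^sub>m n - l \<cdot>\<^sub>m A) = exp (mat_trace A / a * w))))"
    unfolding Let_def
  proof (intro allI impI ballI)
    fix n :: nat and A :: "complex mat" and a l :: complex and D
    assume A: "A \<in> carrier_mat n n" and AA: "A * A = a \<cdot>\<^sub>m A"
      and "\<forall>l\<in>D. 1 - l * a \<noteq> 0" and "l \<in> D"
    then have nz: "(1 - l * a) * (1 / (1 - l * a)) = 1" by simp
    obtain d where t: "mat_trace A = of_nat d * a"
      and det: "\<And>l. det (1\<^sub>m n - l \<cdot>\<^sub>m A) = (1 - l * a) ^ d"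
      by (rule det_complex[OF A AA]) blast
    show "inverts_mat (1\<^sub>m n - l \<cdot>\<^sub>m A) (1\<^sub>m n + (l / (1 - l * a)) \<cdot>\<^sub>m A) \<and>
        inverts_mat (1\<^sub>m n + (l / (1 - l * a)) \<cdot>\<^sub>m A) (1\<^sub>m n - l \<cdot>\<^sub>m A) \<and>
        (a = 0 \<longrightarrow> det (1\<^sub>m n - l \<cdot>\<^sub>m A) = exp (- l * mat_trace A)) \<and>
        (a \<noteq> 0 \<longrightarrow> (\<forall>w. exp w = 1 - l * a \<longrightarrow>
           det (1\<^sub>m n - l \<cdot>\<^sub>m A) = exp (mat_trace A / a * w)))"
      \<comment> \<open>As the trace is \<open>of_nat d * a\<close>, each logarithm \<open>w\<close>
        of \<open>1 - l * a\<close> satisfies \<open>exp (of_nat d * w) = (1 - l * a) ^ d\<close>,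
        whatever the branch.\<close>
      using inverts_one_minus_smult[OF A AA nz]
      by (auto simp: det t exp_of_nat_mult)
  qed
next
  show "complex_algebra smul \<longrightarrow>
      (\<forall>(n::nat) (A::'a mat) (a::'a) (D::complex set).
        A \<in> carrier_mat n n \<longrightarrow> (\<forall>i<n. \<forall>j<n. nilpotent (A $$ (i, j))) \<longrightarrow>
        A * A = a \<cdot>\<^sub>m A \<longrightarrow>
        open D \<longrightarrow> connected D \<longrightarrow> 0 \<in> D \<longrightarrow>
        (\<forall>l\<in>D. (1 - smul l a) dvd 1) \<longrightarrow>
        (\<forall>l\<in>D.
           let M = 1\<^sub>m n - map_mat (smul l) A;
               B = 1\<^sub>m n + smul l (ring_inv (1 - smul l a)) \<cdot>\<^sub>m A in
           inverts_mat M B \<and> inverts_mat B M \<and>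
           det M = nil_exp smul (nil_log_quot smul l a (mat_trace A))))"
    unfolding Let_def
  proof (intro allI impI ballI)
    fix n :: nat and A :: "'a mat" and a :: 'a and l :: complex and D
    assume "complex_algebra smul" and A: "A \<in> carrier_mat n n" and AA: "A * A = a \<cdot>\<^sub>m A"
      and nil: "\<forall>i<n. \<forall>j<n. nilpotent (A $$ (i, j))"
      and "\<forall>l\<in>D. (1 - smul l a) dvd 1" and "l \<in> D"
    then interpret comm_complex_algebra smul
      by (simp add: comm_complex_algebra_def)
    obtain y where y: "(1 - smul l 1 * a) * y = 1"
      using \<open>\<forall>l\<in>D. (1 - smul l a) dvd 1\<close> \<open>l \<in> D\<close> by (metis dvdE smul_one_mult)
    then have "ring_inv (1 - smul l a) = y"
      by (intro ring_inv_eq) (simp_all add: smul_one_mult mult.commute[of y])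
    then have B: "smul l (ring_inv (1 - smul l a)) = smul l 1 * y"
      by (simp add: smul_one_mult)
    have "nilpotent (mat_trace A)"
      using A nil by (intro nilpotent_mat_trace) auto
    then show "inverts_mat (1\<^sub>m n - map_mat (smul l) A)
          (1\<^sub>m n + smul l (ring_inv (1 - smul l a)) \<cdot>\<^sub>m A) \<and>
        inverts_mat (1\<^sub>m n + smul l (ring_inv (1 - smul l a)) \<cdot>\<^sub>m A)
          (1\<^sub>m n - map_mat (smul l) A) \<and>
        det (1\<^sub>m n - map_mat (smul l) A) = nil_exp smul (nil_log_quot smul l a (mat_trace A))"
      using inverts_one_minus_smult[OF A AA y] det_eq_nil_exp[OF A AA]
      unfolding B map_mat_smul by blast
  qed
next
  show "graded_commutative_algebra gsmul Ev Od \<longrightarrow>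
      (\<forall>(k::nat) (\<alpha>::nat \<Rightarrow> 'b) (\<beta>::nat \<Rightarrow> 'b).
        (\<forall>i<k. \<alpha> i \<in> Od \<and> \<beta> i \<in> Od) \<longrightarrow>
        (let A = mat k k (\<lambda>(i, j). \<alpha> i * \<beta> j);
             a = - mat_trace A in
         a = - (\<Sum>i<k. \<alpha> i * \<beta> i) \<and>
         A * A = a \<cdot>\<^sub>m A \<and>
         (\<forall>l::complex.
            (\<exists>y. (1 - gsmul l a) * y = 1 \<and> y * (1 - gsmul l a) = 1) \<and>
            leibniz_det (1\<^sub>m k - map_mat (gsmul l) A) = ring_inv (1 - gsmul l a))))"
    unfolding Let_def
  proof (intro allI impI)
    fix k :: nat and \<alpha> \<beta> :: "nat \<Rightarrow> 'b"
    assume "graded_commutative_algebra gsmul Ev Od" and "\<forall>i<k. \<alpha> i \<in> Od \<and> \<beta> i \<in> Od"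
    then interpret graded_commutative_algebra gsmul Ev Od
      by simp
    let ?A = "mat k k (\<lambda>(i, j). \<alpha> i * \<beta> j)"
    note rank_one = odd_rank_one[OF \<open>\<forall>i<k. \<alpha> i \<in> Od \<and> \<beta> i \<in> Od\<close>]
    show "- mat_trace ?A = - (\<Sum>i<k. \<alpha> i * \<beta> i) \<and> ?A * ?A = - mat_trace ?A \<cdot>\<^sub>m ?A \<and>
        (\<forall>l. (\<exists>y. (1 - gsmul l (- mat_trace ?A)) * y = 1 \<and> y * (1 - gsmul l (- mat_trace ?A)) = 1) \<and>
          leibniz_det (1\<^sub>m k - map_mat (gsmul l) ?A) = ring_inv (1 - gsmul l (- mat_trace ?A)))"
      by (intro conjI allI exI) (fact rank_one | rule ring_inv_eq[OF rank_one(3,4), symmetric])+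
  qed
qed

end
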